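(* Let $P,Q:\subseteq\mathbb{N}^{\mathbb{N}}\rightrightarrows\mathbb{N}^{\mathbb{N}}$ be problems and let $\alpha$ be a countable ordinal. Suppose that $P\le_{\mathrm{W}}^{*}Q$ via forward function $\Phi$ and backward function $\Psi$, and suppose that $p\in\mathrm{dom}(P)$ is a rank-$\alpha$ discontinuity of $P$. Then $\Phi(p)$ is a rank-$\beta$ discontinuity of $Q$ for some $\beta\le\alpha$.
   Context: $\mathbb{N}^{\mathbb{N}}$ is Baire space; $\sigma\sqsubseteq x$ means the finite string $\sigma$ is an initial segment of $x$, and $[\![\sigma]\!]=\{x\in\mathbb{N}^{\mathbb{N}}:\sigma\sqsubseteq x\}$. A problem $P:\subseteq\mathbb{N}^{\mathbb{N}}\rightrightarrows\mathbb{N}^{\mathbb{N}}$ is a partial multivalued function: a set $\mathrm{dom}(P)$ of instances and, for each $p\in\mathrm{dom}(P)$, a set $P(p)\subseteq\mathbb{N}^{\mathbb{N}}$ of solutions; $P(p)=\emptyset$ is allowed. $P|_A$ has domain $\mathrm{dom}(P)\cap A$. $P|[A\times B]$ has domain $\mathrm{dom}(P)\cap A$ and $P|[A\times B](x)=P(x)\cap B$. $P$ is continuous if there is a continuous partial function $\Phi$ defined on $\mathrm{dom}(P)$ with $\Phi(p)\in P(p)$ for all $p\in\mathrm{dom}(P)$. $p\in\mathrm{dom}(P)$ is a discontinuity of $P$ if there is no open neighborhood $U$ of $p$ with $P|_U$ continuous. **Continuous Weihrauch reducibility.** $P\le_{\mathrm{W}}^{*}Q$ via forward function $\Phi$ and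 backward function $\Psi$ if these are continuous partial functions such that for all $p\in\mathrm{dom}(P)$, $\Phi(p)$ is defined and in $\mathrm{dom}(Q)$, and for all $\hat q\in Q(\Phi(p))$, $\Psi(p,\hat q)$ is defined and in $P(p)$. **Rank of discontinuity.** Let $p\in\mathrm{dom}(P)$ be a discontinuity of $P$. If $P(p)=\emptyset$, $p$ is a rank-$0$ discontinuity of $P$. For countable $\alpha>0$ (and $P(p)\ne\emptyset$), $p$ is a rank-$\alpha$ discontinuity of $P$ if $\alpha$ is the least ordinal such that for all $q\in P(p)$ there is a finite $\rho\sqsubseteq q$ such that for all finite $\sigma\sqsubseteq p$ there is $p'\in\mathrm{dom}(P)\cap[\![\sigma]\!]$ with $p'\ne p$ such that $p'$ is a rank-$\beta$ discontinuity of $P|[[\![\sigma]\!]\times[\![\rho]\!]]$ for some $\beta<\alpha$. *)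

theory Defs
  imports "HOL-Analysis.Analysis"
begin

section \<open>The type of countable ordinals\<close>

text \<open>
  The initial ordinal \<open>\<omega>\<^sub>1\<close>, whose elements are the countable ordinals, is the cardinal
  successor of the order type of the natural numbers.
\<close>

typedef countable_ordinal = "Field (cardSuc natLeq)"
  using Field_cardSuc_not_empty[OF natLeq_Card_order] by blast

instantiation countable_ordinal :: linorder
begin

definition less_eq_countable_ordinal :: "countable_ordinal \<Rightarrow> countable_ordinal \<Rightarrow> bool" where
  "\<alpha> \<le> \<beta> \<longleftrightarrow> (Rep_countable_ordinal \<alpha>, Rep_countable_ordinal \<beta>) \<in> cardSuc natLeq"

definition less_countable_ordinal :: "countable_ordinal \<Rightarrow> countable_ordinal \<Rightarrow> bool" where
  "\<alpha> < \<beta> \<longleftrightarrow> \<alpha> \<le> \<beta> \<and> \<not> \<beta> \<le> (\<alpha> :: countable_ordinal)"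

instance
proof -
  have wo: "Well_order (cardSuc natLeq)"
    by (rule cardSuc_Well_order[OF natLeq_Card_order])
  then have r: "refl_on (Field (cardSuc natLeq)) (cardSuc natLeq)" and t: "trans (cardSuc natLeq)"
    and a: "antisym (cardSuc natLeq)" and tot: "total_on (Field (cardSuc natLeq)) (cardSuc natLeq)"
    by (auto simp: order_on_defs)
  show "OFCLASS(countable_ordinal, linorder_class)"
  proof
    fix x y z :: countable_ordinal
    show "x < y \<longleftrightarrow> x \<le> y \<and> \<not> y \<le> x"
      by (rule less_countable_ordinal_def)
    show "x \<le> x"
      unfolding less_eq_countable_ordinal_def
      using refl_onD[OF r] Rep_countable_ordinal by blast
    show "x \<le> y \<Longrightarrow> y \<le> z \<Longrightarrow> x \<le> z"
      unfolding less_eq_countable_ordinal_def using transD[OF t] by blast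
    show "x \<le> y \<Longrightarrow> y \<le> x \<Longrightarrow> x = y"
      unfolding less_eq_countable_ordinal_def
      using antisymD[OF a] by (simp flip: Rep_countable_ordinal_inject)
    show "x \<le> y \<or> y \<le> x"
      unfolding less_eq_countable_ordinal_def
      using Rep_countable_ordinal[of x] Rep_countable_ordinal[of y] tot refl_onD[OF r]
      unfolding total_on_def by (cases "Rep_countable_ordinal x = Rep_countable_ordinal y") auto
  qed
qed

end

lemma less_countable_ordinal_iff:
  "\<alpha> < \<beta> \<longleftrightarrow> (Rep_countable_ordinal \<alpha>, Rep_countable_ordinal \<beta>) \<in> cardSuc natLeq - Id"
  by (simp add: order_less_le less_eq_countable_ordinal_def Rep_countable_ordinal_inject)

instance countable_ordinal :: wellorder
proof (rule wf_wellorderI)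
  have "wf (cardSuc natLeq - Id)"
    using cardSuc_Well_order[OF natLeq_Card_order] by (simp add: well_order_on_def)
  then have "wf (inv_image (cardSuc natLeq - Id) Rep_countable_ordinal)"
    by (rule wf_inv_image)
  then show "wf {(\<alpha>, \<beta> :: countable_ordinal). \<alpha> < \<beta>}"
    by (simp add: inv_image_def less_countable_ordinal_iff)
qed intro_classes

instantiation countable_ordinal :: zero
begin

definition zero_countable_ordinal :: countable_ordinal where
  "0 = (LEAST \<alpha> :: countable_ordinal. True)"

instance ..

end

lemma zero_le_countable_ordinal: "0 \<le> (\<alpha> :: countable_ordinal)"
  unfolding zero_countable_ordinal_def by (simp add: Least_le)

text \<open>
  The lemmas \<open>countable_lessThan_countable_ordinal\<close> and
  \<open>uncountable_UNIV_countable_ordinal\<close> below characterise the order type \<open>\<omega>\<^sub>1\<close> among all well-orders.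
\<close>

lemma countable_iff_card_of_ordLeq_natLeq:
  includes cardinal_syntax
  shows "countable A \<longleftrightarrow> |A| \<le>o natLeq"
proof -
  have "countable A \<longleftrightarrow> |A| \<le>o |UNIV :: nat set|"
    by (auto simp: countable_def simp flip: card_of_ordLeq)
  then show ?thesis
    using ordLeq_ordIso_trans[OF _ card_of_nat] ordLeq_ordIso_trans[OF _ ordIso_symmetric[OF card_of_nat]]
    by blast
qed

lemma countable_lessThan_countable_ordinal:
  includes cardinal_syntax
  shows "countable {..< \<alpha> :: countable_ordinal}"
proof -
  let ?r = "cardSuc natLeq" and ?a = "Rep_countable_ordinal \<alpha>"
  have "|underS ?r ?a| <o ?r"
    by (rule card_of_underS[OF cardSuc_Card_order[OF natLeq_Card_order] Rep_countable_ordinal])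
  then have "|underS ?r ?a| \<le>o natLeq"
    by (simp add: cardSuc_ordLeq_ordLess[OF natLeq_Card_order card_of_Card_order])
  then have "countable (underS ?r ?a)"
    by (simp add: countable_iff_card_of_ordLeq_natLeq)
  moreover have "Rep_countable_ordinal ` {..< \<alpha>} \<subseteq> underS ?r ?a"
    by (auto simp: underS_def less_countable_ordinal_iff)
  ultimately have "countable (Rep_countable_ordinal ` {..< \<alpha>})"
    by (rule countable_subset[rotated])
  then show ?thesis
    by (rule countable_image_inj_on) (simp add: inj_on_def Rep_countable_ordinal_inject)
qed

lemma uncountable_UNIV_countable_ordinal:
  includes cardinal_syntax
  shows "uncountable (UNIV :: countable_ordinal set)"
proof
  assume "countable (UNIV :: countable_ordinal set)"
  then have "countable (range Rep_countable_ordinal)"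
    by simp
  moreover have "range Rep_countable_ordinal = Field (cardSuc natLeq)"
    by (rule type_definition.Rep_range[OF type_definition_countable_ordinal])
  ultimately have "|Field (cardSuc natLeq)| \<le>o natLeq"
    by (simp add: countable_iff_card_of_ordLeq_natLeq)
  then have "cardSuc natLeq \<le>o natLeq"
    using card_of_Field_ordIso[OF cardSuc_Card_order[OF natLeq_Card_order]]
      ordIso_ordLeq_trans ordIso_symmetric by blast
  then show False
    using cardSuc_greater[OF natLeq_Card_order] not_ordLess_ordLeq by blast
qed


section \<open>Baire space and problems\<close>

text \<open>
  The topology on \<open>nat \<Rightarrow> nat\<close> is the library's product topology of discrete spaces.
\<close>

type_synonym baire = "nat \<Rightarrow> nat"

definition initial_segment :: "nat list \<Rightarrow> baire \<Rightarrow> bool" (infix "\<sqsubseteq>" 50) where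
  "\<sigma> \<sqsubseteq> x \<longleftrightarrow> (\<forall>i < length \<sigma>. \<sigma> ! i = x i)"

definition cylinder :: "nat list \<Rightarrow> baire set" where
  "cylinder \<sigma> = {x. \<sigma> \<sqsubseteq> x}"

text \<open>
  In a problem \<open>P\<close>, the value \<open>P p = Some {}\<close> says that \<open>p\<close> is an instance without solutions,
  whereas \<open>P p = None\<close> says that \<open>p\<close> is not an instance.  The term \<open>the (P p)\<close> is only ever
  used for \<open>p \<in> dom P\<close>.  The restriction of \<open>P\<close> to \<open>A\<close> is \<open>P |` A\<close>.
\<close>

type_synonym problem = "baire \<rightharpoonup> baire set"

definition restrict_problem :: "problem \<Rightarrow> baire set \<Rightarrow> baire set \<Rightarrow> problem" where
  "restrict_problem P A B = (\<lambda>x. map_option (\<lambda>S. S \<inter> B) ((P |` A) x))"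

definition continuous_partial ::
    "('a::topological_space \<rightharpoonup> 'b::topological_space) \<Rightarrow> bool" where
  "continuous_partial \<Phi> \<longleftrightarrow> continuous_on (dom \<Phi>) (\<lambda>x. the (\<Phi> x))"

definition continuous_problem :: "problem \<Rightarrow> bool" where
  "continuous_problem P \<longleftrightarrow>
     (\<exists>\<Phi> :: baire \<rightharpoonup> baire. continuous_partial \<Phi> \<and> dom P \<subseteq> dom \<Phi> \<and>
        (\<forall>p \<in> dom P. the (\<Phi> p) \<in> the (P p)))"

definition discontinuity :: "problem \<Rightarrow> baire \<Rightarrow> bool" where
  "discontinuity P p \<longleftrightarrow>
     p \<in> dom P \<and> \<not> (\<exists>U. open U \<and> p \<in> U \<and> continuous_problem (P |` U))"

definition cont_weihrauch_via ::
    "problem \<Rightarrow> problem \<Rightarrow> (baire \<rightharpoonup> baire) \<Rightarrow> (baire \<times> baire \<rightharpoonup> baire) \<Rightarrow> bool" where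
  "cont_weihrauch_via P Q \<Phi> \<Psi> \<longleftrightarrow>
     continuous_partial \<Phi> \<and> continuous_partial \<Psi> \<and>
     (\<forall>p \<in> dom P. p \<in> dom \<Phi> \<and> the (\<Phi> p) \<in> dom Q \<and>
        (\<forall>q \<in> the (Q (the (\<Phi> p))). (p, q) \<in> dom \<Psi> \<and> the (\<Psi> (p, q)) \<in> the (P p)))"


section \<open>Rank of discontinuity\<close>

text \<open>
  The condition of which the rank is the least solution \<open>\<alpha>\<close>.  The parameter \<open>R\<close> stands for the
  rank relation, which is then defined by well-founded recursion on \<open>\<alpha>\<close>; only its values
  \<open>R \<beta>\<close> with \<open>\<beta> < \<alpha>\<close> are used.
\<close>

definition rank_condition ::
    "(countable_ordinal \<Rightarrow> problem \<Rightarrow> baire \<Rightarrow> bool) \<Rightarrow>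
     countable_ordinal \<Rightarrow> problem \<Rightarrow> baire \<Rightarrow> bool" where
  "rank_condition R \<alpha> P p \<longleftrightarrow>
     (\<forall>q \<in> the (P p). \<exists>\<rho>. \<rho> \<sqsubseteq> q \<and>
        (\<forall>\<sigma>. \<sigma> \<sqsubseteq> p \<longrightarrow>
           (\<exists>p' \<in> dom P \<inter> cylinder \<sigma>. p' \<noteq> p \<and>
              (\<exists>\<beta> < \<alpha>. R \<beta> (restrict_problem P (cylinder \<sigma>) (cylinder \<rho>)) p'))))"

lemma rank_condition_cong [fundef_cong]:
  assumes "\<alpha> = \<alpha>'" and "P = P'" and "p = p'"
    and "\<And>\<beta> S x. \<beta> < \<alpha>' \<Longrightarrow> R \<beta> S x = R' \<beta> S x"
  shows "rank_condition R \<alpha> P p = rank_condition R' \<alpha>' P' p'"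
  using assms by (auto simp: rank_condition_def cong: conj_cong)

function rank_discontinuity :: "countable_ordinal \<Rightarrow> problem \<Rightarrow> baire \<Rightarrow> bool" where
  "rank_discontinuity \<alpha> P p \<longleftrightarrow>
     discontinuity P p \<and>
     (if the (P p) = {} then \<alpha> = 0
      else 0 < \<alpha> \<and> rank_condition rank_discontinuity \<alpha> P p \<and>
           (\<forall>\<gamma>. \<gamma> < \<alpha> \<longrightarrow> \<not> rank_condition rank_discontinuity \<gamma> P p))"
  by pat_completeness auto

termination
  by (relation "inv_image {(\<alpha>, \<beta>). \<alpha> < \<beta>} fst") (auto intro: wf)

declare rank_discontinuity.simps [simp del]

end

theory Submission
  imports Defs
begin

text \<open>
  The proof is by strong induction on \<open>\<alpha>\<close>, for all problems and reductions at once.  That \<open>\<Phi> p\<close>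
  is a discontinuity of \<open>Q\<close> is plain: a continuous solution of \<open>Q\<close> near \<open>\<Phi> p\<close> would be
  turned by \<open>\<Phi>\<close> and \<open>\<Psi>\<close> into one of \<open>P\<close> near \<open>p\<close>.  If \<open>\<Phi> p\<close> has no solutions, it has rank \<open>0\<close>.
  Otherwise it suffices that the condition defining the rank holds at \<open>\<alpha>\<close>, because the least
  ordinal satisfying it is then positive and at most \<open>\<alpha>\<close>.

  So let \<open>q\<close> solve \<open>z = \<Phi> p\<close>.  Then \<open>\<Psi> (p, q)\<close> solves \<open>p\<close>, and the rank of \<open>p\<close> provides a
  string \<open>\<rho>'\<close> for it;
  continuity of \<open>\<Psi>\<close> turns \<open>\<rho>'\<close> into a string \<open>\<rho> \<sqsubseteq> q\<close>.  For \<open>\<sigma> \<sqsubseteq> z\<close>,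
  continuity of \<open>\<Phi>\<close> yields \<open>\<sigma>' \<sqsubseteq> p\<close> such that the same \<open>\<Phi>\<close> and \<open>\<Psi>\<close> reduce
  \<open>P|[\<sigma>' \<times> \<rho>']\<close> to \<open>Q|[\<sigma> \<times> \<rho>]\<close>
  (\<open>cont_weihrauch_via_restrict\<close>).  By the induction hypothesis a discontinuity \<open>p'\<close> of the former
  of rank below \<open>\<alpha>\<close> is mapped to a discontinuity \<open>\<Phi> p'\<close> of the latter of rank below \<open>\<alpha>\<close>.

  The one obstacle is that \<open>\<Phi>\<close> need not be injective: possibly \<open>\<Phi> p' = z\<close>, although the
  definition asks for an instance other than \<open>z\<close>.  But then \<open>z\<close> itself is a discontinuity
  of \<open>Q|[\<sigma> \<times> \<rho>]\<close> of rank below \<open>\<alpha>\<close>, positive because \<open>q\<close> is still a solution, and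
  unfolding this rank at \<open>q\<close> gives instances other than \<open>z\<close>
  (\<open>lower_rank_limit_of_restriction\<close>).
\<close>

section \<open>Cylinders\<close>

lemma mem_cylinder [simp]: "x \<in> cylinder \<sigma> \<longleftrightarrow> \<sigma> \<sqsubseteq> x"
  by (simp add: cylinder_def)

lemma open_cylinder: "open (cylinder \<sigma>)"
proof -
  have "cylinder \<sigma> = (\<Pi>\<^sub>E i\<in>UNIV. if i < length \<sigma> then {\<sigma> ! i} else UNIV)"
    by (auto simp: initial_segment_def PiE_def Pi_def split: if_splits)
  moreover have "open \<dots>"
  proof (rule open_PiE)
    show "finite {i. (if i < length \<sigma> then {\<sigma> ! i} else UNIV) \<noteq> UNIV}"
      by (rule finite_subset[of _ "{..<length \<sigma>}"]) auto
  qed (auto simp: open_discrete)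
  ultimately show ?thesis
    by simp
qed

lemma open_contains_cylinder:
  assumes "open U" and "x \<in> U"
  obtains \<sigma> where "\<sigma> \<sqsubseteq> x" and "cylinder \<sigma> \<subseteq> U"
proof -
  obtain X where X: "x \<in> Pi\<^sub>E UNIV X" "finite {i. X i \<noteq> UNIV}" "Pi\<^sub>E UNIV X \<subseteq> U"
    using product_topology_open_contains_basis[of "\<lambda>_. euclidean" UNIV U x] assms
    by (auto simp: open_fun_def)
  obtain n where n: "\<And>i. X i \<noteq> UNIV \<Longrightarrow> i < n"
    using X(2) unfolding finite_nat_set_iff_bounded by blast
  show thesis
  proof
    show "map x [0..<n] \<sqsubseteq> x"
      by (simp add: initial_segment_def)
    show "cylinder (map x [0..<n]) \<subseteq> U"
    proof
      fix y assume "y \<in> cylinder (map x [0..<n])"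
      then have "y i \<in> X i" for i
        using n[of i] X(1) by (cases "i < n") (auto simp: initial_segment_def PiE_iff dest: spec[of _ i])
      then show "y \<in> U"
        using X(3) by (auto simp: PiE_iff)
    qed
  qed
qed

lemma common_refinement_of_initial_segments:
  assumes "\<sigma> \<sqsubseteq> x" and "\<tau> \<sqsubseteq> x"
  obtains \<upsilon> where "\<upsilon> \<sqsubseteq> x" and "cylinder \<upsilon> \<subseteq> cylinder \<sigma>" and "cylinder \<upsilon> \<subseteq> cylinder \<tau>"
proof (rule open_contains_cylinder)
  show "open (cylinder \<sigma> \<inter> cylinder \<tau>)"
    by (intro open_Int open_cylinder)
  show "x \<in> cylinder \<sigma> \<inter> cylinder \<tau>"
    using assms by simp
qed (simp add: that)


section \<open>Restrictions and reductions of problems\<close>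

lemma dom_restrict_problem [simp]: "dom (restrict_problem P A B) = dom P \<inter> A"
  by (auto simp: restrict_problem_def restrict_map_def split: if_splits)

lemma the_restrict_problem [simp]:
  "x \<in> dom P \<Longrightarrow> x \<in> A \<Longrightarrow> the (restrict_problem P A B x) = the (P x) \<inter> B"
  by (auto simp: restrict_problem_def)

lemma cont_weihrauch_viaD:
  assumes "cont_weihrauch_via P Q \<Phi> \<Psi>" and "x \<in> dom P"
  shows "x \<in> dom \<Phi>" and "the (\<Phi> x) \<in> dom Q"
    and "q \<in> the (Q (the (\<Phi> x))) \<Longrightarrow> (x, q) \<in> dom \<Psi>"
    and "q \<in> the (Q (the (\<Phi> x))) \<Longrightarrow> the (\<Psi> (x, q)) \<in> the (P x)"
  using bspec[OF conjunct2[OF conjunct2[OF assms(1)[unfolded cont_weihrauch_via_def]]] assms(2)]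
  by simp_all

lemma cont_weihrauch_via_restrict:
  assumes "cont_weihrauch_via P Q \<Phi> \<Psi>"
    and "\<And>x. x \<in> dom P \<Longrightarrow> x \<in> A' \<Longrightarrow> the (\<Phi> x) \<in> A"
    and "\<And>x q. x \<in> dom P \<Longrightarrow> x \<in> A' \<Longrightarrow> q \<in> the (Q (the (\<Phi> x))) \<Longrightarrow> q \<in> B \<Longrightarrow> the (\<Psi> (x, q)) \<in> B'"
  shows "cont_weihrauch_via (restrict_problem P A' B') (restrict_problem Q A B) \<Phi> \<Psi>"
  unfolding cont_weihrauch_via_def
proof (intro conjI ballI)
  show "continuous_partial \<Phi>" "continuous_partial \<Psi>"
    using assms(1) by (simp_all add: cont_weihrauch_via_def)
next
  fix x assume "x \<in> dom (restrict_problem P A' B')"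
  then have x: "x \<in> dom P" "x \<in> A'"
    by simp_all
  note red = cont_weihrauch_viaD[OF assms(1) x(1)]
  show "x \<in> dom \<Phi>"
    by (rule red(1))
  show dom: "the (\<Phi> x) \<in> dom (restrict_problem Q A B)"
    using red(2) assms(2)[OF x] by simp
  fix q assume "q \<in> the (restrict_problem Q A B (the (\<Phi> x)))"
  then have q: "q \<in> the (Q (the (\<Phi> x)))" "q \<in> B"
    using red(2) assms(2)[OF x] by simp_all
  show "(x, q) \<in> dom \<Psi>"
    using q(1) by (rule red(3))
  show "the (\<Psi> (x, q)) \<in> the (restrict_problem P A' B' x)"
    using red(4)[OF q(1)] assms(3)[OF x q] x by simp
qed

text \<open>Adding instances and removing solutions makes a problem harder.\<close>

lemma cont_weihrauch_via_identity:
  assumes "dom P \<subseteq> dom Q" and "\<And>x. x \<in> dom P \<Longrightarrow> the (Q x) \<subseteq> the (P x)"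
  shows "cont_weihrauch_via P Q Some (\<lambda>(x, q). Some q)"
proof -
  have "(\<lambda>u. the ((\<lambda>(x, q). Some q) u)) = (snd :: baire \<times> baire \<Rightarrow> baire)"
    by auto
  then have "continuous_partial ((\<lambda>(x, q). Some q) :: baire \<times> baire \<rightharpoonup> baire)"
    unfolding continuous_partial_def by (simp only:) (rule continuous_on_snd[OF continuous_on_id])
  then show ?thesis
    using assms by (auto simp: cont_weihrauch_via_def continuous_partial_def dom_def)
qed

text \<open>
  If \<open>\<Theta>\<close> continuously solves \<open>Q\<close> near \<open>\<Phi> p\<close>, then \<open>x \<mapsto> \<Psi> (x, \<Theta> (\<Phi> x))\<close> continuously
  solves \<open>P\<close> near \<open>p\<close>.
\<close>

lemma discontinuity_cont_weihrauch_via: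
  assumes red: "cont_weihrauch_via P Q \<Phi> \<Psi>" and disc: "discontinuity P p"
  shows "discontinuity Q (the (\<Phi> p))"
proof -
  have p: "p \<in> dom P"
    using disc by (simp add: discontinuity_def)
  have \<Phi>: "continuous_on (dom P) (\<lambda>x. the (\<Phi> x))"
  proof (rule continuous_on_subset)
    show "continuous_on (dom \<Phi>) (\<lambda>x. the (\<Phi> x))" "dom P \<subseteq> dom \<Phi>"
      using red cont_weihrauch_viaD(1)[OF red]
      by (auto simp: cont_weihrauch_via_def continuous_partial_def)
  qed
  have "False" if U: "open U" "the (\<Phi> p) \<in> U" and cont: "continuous_problem (Q |` U)" for U
  proof -
    obtain V where V: "open V" "p \<in> V" "\<And>x. x \<in> dom P \<Longrightarrow> x \<in> V \<Longrightarrow> the (\<Phi> x) \<in> U"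
      using \<Phi> p U unfolding continuous_on_topological by meson
    obtain \<Theta> :: "baire \<rightharpoonup> baire" where \<Theta>: "continuous_partial \<Theta>" "dom Q \<inter> U \<subseteq> dom \<Theta>"
      and sol: "\<And>x. x \<in> dom Q \<Longrightarrow> x \<in> U \<Longrightarrow> the (\<Theta> x) \<in> the (Q x)"
      using cont unfolding continuous_problem_def by auto
    define s where "s x = the (\<Psi> (x, the (\<Theta> (the (\<Phi> x)))))" for x
    have maps: "the (\<Phi> x) \<in> dom Q \<inter> U" if "x \<in> dom P \<inter> V" for x
      using that V(3)[of x] cont_weihrauch_viaD(2)[OF red, of x] by simp
    have "continuous_on (dom P \<inter> V) (\<lambda>x. the (\<Theta> (the (\<Phi> x))))"
    proof (rule continuous_on_compose2[of "dom \<Theta>" "\<lambda>y. the (\<Theta> y)"])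
      show "continuous_on (dom \<Theta>) (\<lambda>y. the (\<Theta> y))"
        using \<Theta>(1) by (simp add: continuous_partial_def)
      show "continuous_on (dom P \<inter> V) (\<lambda>x. the (\<Phi> x))"
        using \<Phi> by (rule continuous_on_subset) (rule Int_lower1)
      show "(\<lambda>x. the (\<Phi> x)) ` (dom P \<inter> V) \<subseteq> dom \<Theta>"
        by (rule image_subsetI) (rule subsetD[OF \<Theta>(2) maps])
    qed
    then have pair: "continuous_on (dom P \<inter> V) (\<lambda>x. (x, the (\<Theta> (the (\<Phi> x)))))"
      by (rule continuous_on_Pair[OF continuous_on_id])
    have s: "continuous_on (dom P \<inter> V) s"
      unfolding s_def
    proof (rule continuous_on_compose2[OF _ pair])
      show "continuous_on (dom \<Psi>) (\<lambda>u. the (\<Psi> u))"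
        using red by (simp add: cont_weihrauch_via_def continuous_partial_def)
      show "(\<lambda>x. (x, the (\<Theta> (the (\<Phi> x))))) ` (dom P \<inter> V) \<subseteq> dom \<Psi>"
      proof (rule image_subsetI)
        fix x assume x: "x \<in> dom P \<inter> V"
        show "(x, the (\<Theta> (the (\<Phi> x)))) \<in> dom \<Psi>"
          using cont_weihrauch_viaD(3)[OF red _ sol] x maps[OF x] by simp
      qed
    qed
    define S where "S = (\<lambda>x. Some (s x)) |` (dom P \<inter> V)"
    have S: "dom S = dom P \<inter> V" "\<And>x. x \<in> dom P \<inter> V \<Longrightarrow> the (S x) = s x"
      by (auto simp: S_def restrict_map_def dom_def)
    have "continuous_partial S"
      unfolding continuous_partial_def using s continuous_on_cong[OF S(1) S(2)] S(1) by simp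
    moreover have "the (S x) \<in> the (P x)" if "x \<in> dom P \<inter> V" for x
      unfolding S(2)[OF that] s_def
      using cont_weihrauch_viaD(4)[OF red _ sol] that maps[OF that] by simp
    ultimately have "continuous_problem (P |` V)"
      unfolding continuous_problem_def using S(1) by (intro exI[of _ S]) auto
    then show False
      using disc V(1,2) unfolding discontinuity_def by blast
  qed
  moreover have "the (\<Phi> p) \<in> dom Q"
    using red p by (simp add: cont_weihrauch_via_def)
  ultimately show ?thesis
    unfolding discontinuity_def by blast
qed


section \<open>Transport of the rank\<close>

text \<open>The demand that the definition of rank \<open>\<alpha>\<close> makes on the string \<open>\<rho>\<close> chosen for a solution.\<close>

definition lower_rank_limit :: "countable_ordinal \<Rightarrow> problem \<Rightarrow> baire \<Rightarrow> nat list \<Rightarrow> bool" where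
  "lower_rank_limit \<alpha> P p \<rho> \<longleftrightarrow>
     (\<forall>\<sigma>. \<sigma> \<sqsubseteq> p \<longrightarrow>
        (\<exists>p' \<in> dom P \<inter> cylinder \<sigma>. p' \<noteq> p \<and>
           (\<exists>\<beta> < \<alpha>. rank_discontinuity \<beta> (restrict_problem P (cylinder \<sigma>) (cylinder \<rho>)) p')))"

lemma rank_condition_iff_lower_rank_limit:
  "rank_condition rank_discontinuity \<alpha> P p \<longleftrightarrow>
     (\<forall>q \<in> the (P p). \<exists>\<rho>. \<rho> \<sqsubseteq> q \<and> lower_rank_limit \<alpha> P p \<rho>)"
  by (simp add: rank_condition_def lower_rank_limit_def)

lemma not_lower_rank_limit_zero: "\<not> lower_rank_limit 0 P p \<rho>"
proof -
  have "[] \<sqsubseteq> p"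
    by (simp add: initial_segment_def)
  then show ?thesis
    unfolding lower_rank_limit_def using zero_le_countable_ordinal by (meson not_le)
qed

lemma rank_discontinuity_imp_discontinuity:
  "rank_discontinuity \<alpha> P p \<Longrightarrow> discontinuity P p"
  by (simp add: rank_discontinuity.simps[of \<alpha> P p])

lemma lower_rank_limit_if_rank_discontinuity:
  assumes "rank_discontinuity \<alpha> P p" and "q \<in> the (P p)"
  obtains \<rho> where "\<rho> \<sqsubseteq> q" and "lower_rank_limit \<alpha> P p \<rho>"
proof -
  have "rank_condition rank_discontinuity \<alpha> P p"
    using assms unfolding rank_discontinuity.simps[of \<alpha> P p] by (auto split: if_splits)
  then show thesis
    using assms(2) that unfolding rank_condition_iff_lower_rank_limit by metis
qed

lemma rank_discontinuity_le_if_lower_rank_limit: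
  assumes disc: "discontinuity P p"
    and lim: "\<And>q. q \<in> the (P p) \<Longrightarrow> \<exists>\<rho>. \<rho> \<sqsubseteq> q \<and> lower_rank_limit \<alpha> P p \<rho>"
  shows "\<exists>\<beta> \<le> \<alpha>. rank_discontinuity \<beta> P p"
proof (cases "the (P p) = {}")
  case True
  then show ?thesis
    using disc by (intro exI[of _ 0])
      (simp add: rank_discontinuity.simps[of 0 P p] zero_le_countable_ordinal)
next
  case False
  let ?C = "\<lambda>\<gamma>. rank_condition rank_discontinuity \<gamma> P p"
  define \<beta> where "\<beta> = (LEAST \<gamma>. ?C \<gamma>)"
  have "?C \<alpha>"
    using lim by (simp add: rank_condition_iff_lower_rank_limit)
  then have \<beta>: "?C \<beta>" "\<beta> \<le> \<alpha>"
    unfolding \<beta>_def by (auto intro: LeastI Least_le)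
  have "\<beta> \<noteq> 0"
    using \<beta>(1) False by (auto simp: rank_condition_iff_lower_rank_limit not_lower_rank_limit_zero)
  then have "0 < \<beta>"
    using zero_le_countable_ordinal[of \<beta>] by (simp add: order_less_le)
  moreover have "\<not> ?C \<gamma>" if "\<gamma> < \<beta>" for \<gamma>
    using that not_less_Least unfolding \<beta>_def by blast
  ultimately have "rank_discontinuity \<beta> P p"
    using disc False \<beta>(1) by (simp add: rank_discontinuity.simps[of \<beta> P p])
  then show ?thesis
    using \<beta>(2) by blast
qed

text \<open>
  This handles a forward function that sends a nearby instance to \<open>z\<close> itself.  The rank of \<open>z\<close> in
  the restriction provides, for the solution \<open>q\<close>, a string \<open>\<rho>\<^sub>0\<close> and discontinuities other than
  \<open>z\<close> of smaller restrictions.  Passing to common refinements of \<open>\<sigma>\<close> with the given initial segment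
  of \<open>z\<close>, and of \<open>\<rho>\<close> with \<open>\<rho>\<^sub>0\<close>, makes these discontinuities serve for \<open>Q\<close>.  The assumption
  \<open>transport\<close> is the special case of identity reductions of the theorem, below \<open>\<beta>\<close>, which the
  induction supplies; it carries a discontinuity over to a problem with more instances and fewer
  solutions.
\<close>

lemma lower_rank_limit_of_restriction:
  assumes transport: "\<And>\<gamma> P' Q' x. \<gamma> < \<beta> \<Longrightarrow> cont_weihrauch_via P' Q' Some (\<lambda>(x, q). Some q) \<Longrightarrow>
        rank_discontinuity \<gamma> P' x \<Longrightarrow> \<exists>\<delta> \<le> \<gamma>. rank_discontinuity \<delta> Q' x"
    and rank: "rank_discontinuity \<beta> (restrict_problem Q (cylinder \<sigma>) (cylinder \<rho>)) z"
    and q: "q \<in> the (Q z)" "\<rho> \<sqsubseteq> q"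
  obtains \<rho>' where "\<rho>' \<sqsubseteq> q" and "lower_rank_limit \<beta> Q z \<rho>'"
proof -
  let ?Q = "restrict_problem Q (cylinder \<sigma>) (cylinder \<rho>)"
  have z: "z \<in> dom Q" "\<sigma> \<sqsubseteq> z"
    using rank_discontinuity_imp_discontinuity[OF rank] by (auto simp: discontinuity_def)
  then have "q \<in> the (?Q z)"
    using q by simp
  then obtain \<rho>\<^sub>0 where \<rho>\<^sub>0: "\<rho>\<^sub>0 \<sqsubseteq> q" "lower_rank_limit \<beta> ?Q z \<rho>\<^sub>0"
    using rank lower_rank_limit_if_rank_discontinuity by blast
  obtain \<rho>' where \<rho>': "\<rho>' \<sqsubseteq> q" "cylinder \<rho>' \<subseteq> cylinder \<rho>" "cylinder \<rho>' \<subseteq> cylinder \<rho>\<^sub>0"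
    using common_refinement_of_initial_segments q(2) \<rho>\<^sub>0(1) by blast
  have "lower_rank_limit \<beta> Q z \<rho>'"
    unfolding lower_rank_limit_def
  proof (intro allI impI)
    fix \<tau> assume "\<tau> \<sqsubseteq> z"
    then obtain \<upsilon> where \<upsilon>: "\<upsilon> \<sqsubseteq> z" "cylinder \<upsilon> \<subseteq> cylinder \<sigma>" "cylinder \<upsilon> \<subseteq> cylinder \<tau>"
      using common_refinement_of_initial_segments z(2) by blast
    let ?Q' = "restrict_problem ?Q (cylinder \<upsilon>) (cylinder \<rho>\<^sub>0)"
    obtain x \<gamma> where x: "x \<in> dom ?Q \<inter> cylinder \<upsilon>" "x \<noteq> z"
      and \<gamma>: "\<gamma> < \<beta>" "rank_discontinuity \<gamma> ?Q' x"
      using \<rho>\<^sub>0(2)[unfolded lower_rank_limit_def, rule_format, OF \<upsilon>(1)] by meson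
    have "cont_weihrauch_via ?Q' (restrict_problem Q (cylinder \<tau>) (cylinder \<rho>'))
        Some (\<lambda>(x, q). Some q)"
    proof (rule cont_weihrauch_via_identity)
      show "dom ?Q' \<subseteq> dom (restrict_problem Q (cylinder \<tau>) (cylinder \<rho>'))"
        using \<upsilon>(3) by auto
    next
      fix y assume y: "y \<in> dom ?Q'"
      then have "y \<in> cylinder \<tau>"
        using \<upsilon>(3) by auto
      then show "the (restrict_problem Q (cylinder \<tau>) (cylinder \<rho>') y) \<subseteq> the (?Q' y)"
        using y \<rho>'(2,3) by auto
    qed
    then obtain \<delta> where "\<delta> < \<beta>"
        "rank_discontinuity \<delta> (restrict_problem Q (cylinder \<tau>) (cylinder \<rho>')) x"
      using transport[OF \<gamma>(1) _ \<gamma>(2)] \<gamma>(1) by (meson le_less_trans)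
    moreover have "x \<in> dom Q \<inter> cylinder \<tau>"
      using x(1) \<upsilon>(3) by auto
    ultimately show "\<exists>p' \<in> dom Q \<inter> cylinder \<tau>. p' \<noteq> z \<and> (\<exists>\<delta> < \<beta>.
        rank_discontinuity \<delta> (restrict_problem Q (cylinder \<tau>) (cylinder \<rho>')) p')"
      using x(2) by metis
  qed
  with \<rho>'(1) show thesis
    by (rule that)
qed

lemma lower_rank_limit_mono:
  assumes "lower_rank_limit \<beta> P p \<rho>" and "\<beta> \<le> \<alpha>"
  shows "lower_rank_limit \<alpha> P p \<rho>"
  unfolding lower_rank_limit_def
proof (intro allI impI)
  fix \<sigma> assume "\<sigma> \<sqsubseteq> p"
  from assms(1)[unfolded lower_rank_limit_def, rule_format, OF this]
  obtain x \<gamma> where x: "x \<in> dom P \<inter> cylinder \<sigma>" "x \<noteq> p" and "\<gamma> < \<beta>"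
    and rank: "rank_discontinuity \<gamma> (restrict_problem P (cylinder \<sigma>) (cylinder \<rho>)) x"
    by meson
  then have "\<gamma> < \<alpha>"
    using assms(2) by simp
  with x rank show "\<exists>p' \<in> dom P \<inter> cylinder \<sigma>. p' \<noteq> p \<and>
      (\<exists>\<gamma> < \<alpha>. rank_discontinuity \<gamma> (restrict_problem P (cylinder \<sigma>) (cylinder \<rho>)) p')"
    by metis
qed

lemma rank_discontinuity_cont_weihrauch_via:
  assumes "cont_weihrauch_via P Q \<Phi> \<Psi>" and "rank_discontinuity \<alpha> P p"
  shows "\<exists>\<beta> \<le> \<alpha>. rank_discontinuity \<beta> Q (the (\<Phi> p))"
  using assms
proof (induction \<alpha> arbitrary: P Q \<Phi> \<Psi> p rule: less_induct)
  case (less \<alpha>)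
  note red = less.prems(1) and rank = less.prems(2)
  define z where "z = the (\<Phi> p)"
  have disc: "discontinuity P p"
    using rank by (rule rank_discontinuity_imp_discontinuity)
  then have p: "p \<in> dom P"
    by (simp add: discontinuity_def)
  have limit: "\<exists>\<rho>. \<rho> \<sqsubseteq> q \<and> lower_rank_limit \<alpha> Q z \<rho>" if q: "q \<in> the (Q z)" for q
  proof -
    have pq: "(p, q) \<in> dom \<Psi>" "the (\<Psi> (p, q)) \<in> the (P p)"
      using cont_weihrauch_viaD(3,4)[OF red p] q unfolding z_def by simp_all
    then obtain \<rho>' where \<rho>': "\<rho>' \<sqsubseteq> the (\<Psi> (p, q))" "lower_rank_limit \<alpha> P p \<rho>'"
      using rank lower_rank_limit_if_rank_discontinuity by blast
    have "continuous_on (dom \<Psi>) (\<lambda>u. the (\<Psi> u))"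
      using red by (simp add: cont_weihrauch_via_def continuous_partial_def)
    then obtain N where N: "open N" "(p, q) \<in> N"
        "\<And>u. u \<in> dom \<Psi> \<Longrightarrow> u \<in> N \<Longrightarrow> the (\<Psi> u) \<in> cylinder \<rho>'"
      unfolding continuous_on_topological
      using pq(1) \<rho>'(1) open_cylinder[of \<rho>'] mem_cylinder by meson
    \<comment> \<open>The string \<open>\<rho>\<close> must be fixed before \<open>\<sigma>\<close>; \<open>U\<close> only constrains the later choice of \<open>\<sigma>'\<close>.\<close>
    obtain U V where UV: "open U" "open V" "p \<in> U" "q \<in> V" "U \<times> V \<subseteq> N"
      using open_prod_elim[OF N(1,2)] by (metis SigmaD1 SigmaD2)
    obtain \<rho> where \<rho>: "\<rho> \<sqsubseteq> q" "cylinder \<rho> \<subseteq> V"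
      using open_contains_cylinder UV(2,4) by blast
    have image: "\<exists>x \<in> dom Q \<inter> cylinder \<sigma>. \<exists>\<beta> < \<alpha>.
        rank_discontinuity \<beta> (restrict_problem Q (cylinder \<sigma>) (cylinder \<rho>)) x"
      if \<sigma>: "\<sigma> \<sqsubseteq> z" for \<sigma>
    proof -
      have "continuous_on (dom \<Phi>) (\<lambda>x. the (\<Phi> x))" "p \<in> dom \<Phi>"
        using red cont_weihrauch_viaD(1)[OF red p]
        by (simp_all add: cont_weihrauch_via_def continuous_partial_def)
      then obtain M where M: "open M" "p \<in> M"
          "\<And>x. x \<in> dom \<Phi> \<Longrightarrow> x \<in> M \<Longrightarrow> the (\<Phi> x) \<in> cylinder \<sigma>"
        unfolding continuous_on_topological
        using \<sigma> open_cylinder[of \<sigma>] mem_cylinder z_def by meson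
      obtain \<sigma>' where \<sigma>': "\<sigma>' \<sqsubseteq> p" "cylinder \<sigma>' \<subseteq> M \<inter> U"
        using open_contains_cylinder[of "M \<inter> U" p] M(1,2) UV(1,3) by blast
      have red': "cont_weihrauch_via (restrict_problem P (cylinder \<sigma>') (cylinder \<rho>'))
          (restrict_problem Q (cylinder \<sigma>) (cylinder \<rho>)) \<Phi> \<Psi>"
      proof (rule cont_weihrauch_via_restrict[OF red])
        fix x assume x: "x \<in> dom P" "x \<in> cylinder \<sigma>'"
        show "the (\<Phi> x) \<in> cylinder \<sigma>"
          using M(3)[OF cont_weihrauch_viaD(1)[OF red x(1)]] x(2) \<sigma>'(2) by blast
        fix y assume y: "y \<in> the (Q (the (\<Phi> x)))" "y \<in> cylinder \<rho>"
        then have "(x, y) \<in> dom \<Psi>"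
          using cont_weihrauch_viaD(3)[OF red x(1)] by simp
        moreover have "(x, y) \<in> N"
          using x(2) y(2) \<sigma>'(2) \<rho>(2) UV(5) by blast
        ultimately show "the (\<Psi> (x, y)) \<in> cylinder \<rho>'"
          by (rule N(3))
      qed
      obtain p' \<gamma> where p': "\<gamma> < \<alpha>"
          "rank_discontinuity \<gamma> (restrict_problem P (cylinder \<sigma>') (cylinder \<rho>')) p'"
        using \<rho>'(2)[unfolded lower_rank_limit_def, rule_format, OF \<sigma>'(1)] by meson
      obtain \<beta> where \<beta>: "\<beta> < \<alpha>"
          "rank_discontinuity \<beta> (restrict_problem Q (cylinder \<sigma>) (cylinder \<rho>)) (the (\<Phi> p'))"
        using less.IH[OF p'(1) red' p'(2)] p'(1) by (meson le_less_trans)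
      moreover have "the (\<Phi> p') \<in> dom Q \<inter> cylinder \<sigma>"
        using rank_discontinuity_imp_discontinuity[OF \<beta>(2)] by (simp add: discontinuity_def)
      ultimately show ?thesis
        by metis
    qed
    show ?thesis
    proof (cases "\<exists>\<sigma> \<beta>. \<beta> < \<alpha> \<and>
        rank_discontinuity \<beta> (restrict_problem Q (cylinder \<sigma>) (cylinder \<rho>)) z")
      case True
      \<comment> \<open>The discontinuity provided by \<open>image\<close> may be \<open>z\<close>, so \<open>\<rho>\<close> may fail and is replaced.\<close>
      then obtain \<sigma> \<beta> where \<beta>: "\<beta> < \<alpha>"
          "rank_discontinuity \<beta> (restrict_problem Q (cylinder \<sigma>) (cylinder \<rho>)) z"
        by metis
      obtain \<rho>'' where "\<rho>'' \<sqsubseteq> q" "lower_rank_limit \<beta> Q z \<rho>''"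
      proof (rule lower_rank_limit_of_restriction[where \<beta> = \<beta> and Q = Q and z = z and q = q
            and \<sigma> = \<sigma> and \<rho> = \<rho>])
        fix \<gamma> P' Q' x
        assume "\<gamma> < \<beta>" "cont_weihrauch_via P' Q' Some (\<lambda>(x, q). Some q)" "rank_discontinuity \<gamma> P' x"
        then show "\<exists>\<delta> \<le> \<gamma>. rank_discontinuity \<delta> Q' x"
          using less.IH[OF less_trans[OF _ \<beta>(1)], of \<gamma> P' Q' Some _ x] by simp
      qed (rule \<beta>(2), rule q, rule \<rho>(1))
      then show ?thesis
        using \<beta>(1) lower_rank_limit_mono[of \<beta> Q z _ \<alpha>] less_imp_le by metis
    next
      case False
      \<comment> \<open>The discontinuities provided by \<open>image\<close> all differ from \<open>z\<close>.\<close>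
      then have "lower_rank_limit \<alpha> Q z \<rho>"
        unfolding lower_rank_limit_def using image by metis
      then show ?thesis
        using \<rho>(1) by metis
    qed
  qed
  have "discontinuity Q z"
    unfolding z_def using red disc by (rule discontinuity_cont_weihrauch_via)
  then have "\<exists>\<beta> \<le> \<alpha>. rank_discontinuity \<beta> Q z"
  proof (rule rank_discontinuity_le_if_lower_rank_limit)
    fix q assume "q \<in> the (Q z)"
    then show "\<exists>\<rho>. \<rho> \<sqsubseteq> q \<and> lower_rank_limit \<alpha> Q z \<rho>"
      by (rule limit)
  qed
  then show ?case
    by (simp only: z_def)
qed

theorem corollary4p2p14:
  fixes P Q :: problem
    and \<alpha> :: countable_ordinal
    and \<Phi> :: "baire \<rightharpoonup> baire"
    and \<Psi> :: "baire \<times> baire \<rightharpoonup> baire"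
    and p :: baire
  assumes "cont_weihrauch_via P Q \<Phi> \<Psi>"
    and "p \<in> dom P"
    and "rank_discontinuity \<alpha> P p"
  shows "\<exists>\<beta> \<le> \<alpha>. rank_discontinuity \<beta> Q (the (\<Phi> p))"
  using assms(1,3) by (rule rank_discontinuity_cont_weihrauch_via)

end
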